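(* Every paving matroid has property (P+): for any pair $A,B$ of bases of the matroid, there exists a path with vertex set $A\triangle B$ that alternates between $A\setminus B$ and $B\setminus A$ and covers $\mathcal{C}[A\cup B]$.
   Context: A rank-$r$ matroid is paving if every set of size at most $r-1$ is independent. For a matroid with circuit set $\mathcal{C}$ and a subset $X$ of the ground set, $\mathcal{C}[X]$ is the set of circuits contained in $X$. A path whose vertex set is a set of matroid elements covers a family of circuits if every circuit in the family contains both endpoints of some edge of the path. *)

theory Defs
  imports Main
begin

locale matroid =
  fixes E :: "'a set" and indep :: "'a set \<Rightarrow> bool"
  assumes finite_ground: "finite E"
    and indep_subset_ground: "indep X \<Longrightarrow> X \<subseteq> E"
    and indep_empty: "indep {}"
    and indep_mono: "indep X \<Longrightarrow> Y \<subseteq> X \<Longrightarrow> indep Y"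
    and indep_augment: "indep X \<Longrightarrow> indep Y \<Longrightarrow> card X < card Y \<Longrightarrow> \<exists>y\<in>Y - X. indep (insert y X)"

definition basis :: "'a set \<Rightarrow> ('a set \<Rightarrow> bool) \<Rightarrow> 'a set \<Rightarrow> bool" where
  "basis E indep B \<longleftrightarrow> B \<subseteq> E \<and> indep B \<and> (\<forall>X\<subseteq>E. indep X \<longrightarrow> B \<subseteq> X \<longrightarrow> X = B)"

definition circuit :: "'a set \<Rightarrow> ('a set \<Rightarrow> bool) \<Rightarrow> 'a set \<Rightarrow> bool" where
  "circuit E indep C \<longleftrightarrow> C \<subseteq> E \<and> \<not> indep C \<and> (\<forall>X. X \<subset> C \<longrightarrow> indep X)"

definition matroid_rank :: "'a set \<Rightarrow> ('a set \<Rightarrow> bool) \<Rightarrow> nat" where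
  "matroid_rank E indep = Max (card ` {X. X \<subseteq> E \<and> indep X})"

(* "card X < r" is "card X \<le> r - 1" without truncated subtraction *)
definition paving :: "'a set \<Rightarrow> ('a set \<Rightarrow> bool) \<Rightarrow> bool" where
  "paving E indep \<longleftrightarrow> (\<forall>X\<subseteq>E. card X < matroid_rank E indep \<longrightarrow> indep X)"

definition circuits_in :: "'a set \<Rightarrow> ('a set \<Rightarrow> bool) \<Rightarrow> 'a set \<Rightarrow> 'a set set" where
  "circuits_in E indep X = {C. circuit E indep C \<and> C \<subseteq> X}"

(* A path is the list of its vertices in order; the empty list is the path
   with empty vertex set. *)
definition path_on :: "'a set \<Rightarrow> 'a list \<Rightarrow> bool" where
  "path_on V p \<longleftrightarrow> distinct p \<and> set p = V"

definition path_edges :: "'a list \<Rightarrow> 'a set set" where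
  "path_edges p = {{p ! i, p ! Suc i} | i. Suc i < length p}"

definition alternates :: "'a set \<Rightarrow> 'a set \<Rightarrow> 'a list \<Rightarrow> bool" where
  "alternates X Y p \<longleftrightarrow> (\<forall>i. Suc i < length p \<longrightarrow>
     (p ! i \<in> X \<and> p ! Suc i \<in> Y) \<or> (p ! i \<in> Y \<and> p ! Suc i \<in> X))"

definition covers :: "'a list \<Rightarrow> 'a set set \<Rightarrow> bool" where
  "covers p \<C> \<longleftrightarrow> (\<forall>C\<in>\<C>. \<exists>e\<in>path_edges p. e \<subseteq> C)"

definition property_P_plus :: "'a set \<Rightarrow> ('a set \<Rightarrow> bool) \<Rightarrow> bool" where
  "property_P_plus E indep \<longleftrightarrow>
     (\<forall>A B. basis E indep A \<longrightarrow> basis E indep B \<longrightarrow>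
       (\<exists>p. path_on (sym_diff A B) p \<and> alternates (A - B) (B - A) p \<and>
            covers p (circuits_in E indep (A \<union> B))))"

end

theory Submission
  imports Defs
begin

text \<open>
  Let \<open>n = |A - B|\<close>. Exchanging the elements of \<open>B - A\<close> one at a time for elements of \<open>A - B\<close>
  gives orderings \<open>a\<^sub>1, \<dots>, a\<^sub>n\<close> and \<open>b\<^sub>1, \<dots>, b\<^sub>n\<close> such that every set
  \<open>(A \<inter> B) \<union> {a\<^sub>1, \<dots>, a\<^sub>j} \<union> {b\<^sub>j\<^sub>+\<^sub>1, \<dots>, b\<^sub>n}\<close> is a basis. Take the path
  \<open>a\<^sub>1 b\<^sub>1 a\<^sub>2 b\<^sub>2 \<dots> a\<^sub>n b\<^sub>n\<close>. A set of path vertices containing no edge has at most \<open>n\<close> elements,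
  and those with exactly \<open>n\<close> elements are the sets \<open>{a\<^sub>1, \<dots>, a\<^sub>j} \<union> {b\<^sub>j\<^sub>+\<^sub>1, \<dots>, b\<^sub>n}\<close>.
  In a paving matroid a circuit \<open>C \<subseteq> A \<union> B\<close> has at least \<open>|A|\<close> elements, so at least \<open>n\<close> of them
  lie on the path; if \<open>C\<close> contained no edge it would be one of the bases above.
\<close>

text \<open>Keeping \<open>a\<^sub>i\<close> and \<open>b\<^sub>i\<close> in one pair lets a single
  index \<open>j\<close> cut both orderings: \<open>take j\<close> for the first components,
  \<open>drop j\<close> for the second.\<close>

definition interleave :: "('a \<times> 'a) list \<Rightarrow> 'a list" where
  "interleave ps = concat (map (\<lambda>(a, b). [a, b]) ps)"

lemma interleave_simps [simp]:
  "interleave [] = []"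
  "interleave ((a, b) # ps) = a # b # interleave ps"
  by (simp_all add: interleave_def)

lemma set_interleave: "set (interleave ps) = fst ` set ps \<union> snd ` set ps"
  by (force simp: interleave_def)

lemma length_interleave: "length (interleave ps) = 2 * length ps"
  by (induction ps) auto

lemma alternates_interleave:
  assumes "fst ` set ps \<subseteq> X" and "snd ` set ps \<subseteq> Y"
  shows "alternates X Y (interleave ps)"
proof -
  have "successively (\<lambda>u v. u \<in> X \<and> v \<in> Y \<or> u \<in> Y \<and> v \<in> X) (interleave ps)"
    using assms
  proof (induction ps)
    case (Cons x ps)
    then show ?case by (cases x; cases ps) auto
  qed simp
  then show ?thesis
    by (simp add: alternates_def successively_conv_nth)
qed

text \<open>The two entries of a pair are adjacent, so each pair contributes at most one element of
  \<open>I\<close>. In the case of equality each contributes exactly one, and a chosen second entry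
  excludes the first entry of the next pair. Hence the choice switches from first to second entries
  at most once, after \<open>j\<close> pairs.\<close>

lemma edge_free_interleave:
  assumes "successively (\<lambda>u v. \<not> (u \<in> I \<and> v \<in> I)) (interleave ps)"
  shows "length (filter (\<lambda>u. u \<in> I) (interleave ps)) \<le> length ps \<and>
    (length (filter (\<lambda>u. u \<in> I) (interleave ps)) = length ps \<longrightarrow>
      (\<exists>j\<le>length ps. set (filter (\<lambda>u. u \<in> I) (interleave ps)) =
        fst ` set (take j ps) \<union> snd ` set (drop j ps)))"
  using assms
proof (induction ps)
  case Nil
  then show ?case by simp
next
  case (Cons x ps)
  obtain a b where x: "x = (a, b)" by fastforce
  let ?F = "\<lambda>qs. filter (\<lambda>u. u \<in> I) (interleave qs)"
  have ab: "\<not> (a \<in> I \<and> b \<in> I)"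
    using Cons.prems by (simp add: x)
  have "successively (\<lambda>u v. \<not> (u \<in> I \<and> v \<in> I)) (interleave ps)"
    using Cons.prems by (cases "interleave ps = []") (auto simp: x successively_Cons)
  note IH = Cons.IH[OF this]
  have le: "length (?F (x # ps)) \<le> length (x # ps)"
    using IH ab by (auto simp: x)
  moreover have "\<exists>j\<le>length (x # ps). set (?F (x # ps)) =
      fst ` set (take j (x # ps)) \<union> snd ` set (drop j (x # ps))"
    if eq: "length (?F (x # ps)) = length (x # ps)"
  proof -
    have "a \<in> I \<or> b \<in> I" and "length (?F ps) = length ps"
      using eq IH ab by (auto simp: x split: if_splits)
    then obtain j where j: "j \<le> length ps"
      "set (?F ps) = fst ` set (take j ps) \<union> snd ` set (drop j ps)"
      using IH by blast
    show ?thesis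
    proof (cases "b \<in> I")
      case False
      then have "set (?F (x # ps)) =
          fst ` set (take (Suc j) (x # ps)) \<union> snd ` set (drop (Suc j) (x # ps))"
        using \<open>a \<in> I \<or> b \<in> I\<close> j(2) by (simp add: x)
      then show ?thesis
        using j(1) by (intro exI[of _ "Suc j"]) simp
    next
      case True
      \<comment> \<open>As \<open>b\<close> is chosen, the next first entry \<open>c\<close> is not,
        so the tail consists of second entries throughout.\<close>
      have "set (?F ps) = snd ` set ps"
      proof (cases ps)
        case (Cons y qs)
        obtain c d where y: "y = (c, d)" by fastforce
        have "c \<notin> I"
          using Cons.prems True by (simp add: x y Cons)
        have "j = 0"
        proof (rule ccontr)
          assume "j \<noteq> 0"
          then have "c \<in> fst ` set (take j ps)"
            by (cases j) (auto simp: Cons y)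
          then have "c \<in> set (?F ps)"
            using j(2) by blast
          then show False
            using \<open>c \<notin> I\<close> by simp
        qed
        then show ?thesis using j(2) by simp
      qed simp
      then show ?thesis
        using True ab by (intro exI[of _ 0]) (auto simp: x)
    qed
  qed
  ultimately show ?case by blast
qed

context matroid
begin

lemma indep_finite: "indep X \<Longrightarrow> finite X"
  using finite_ground indep_subset_ground finite_subset by blast

lemma basis_card_max:
  assumes "basis E indep B" and "indep X"
  shows "card X \<le> card B"
proof (rule ccontr)
  assume "\<not> card X \<le> card B"
  then obtain y where "y \<in> X - B" "indep (insert y B)"
    using assms indep_augment[of B X] by (auto simp: basis_def)
  then show False
    using assms(1) indep_subset_ground unfolding basis_def by blast
qed

lemma card_basis:
  assumes "basis E indep B"
  shows "card B = matroid_rank E indep"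
  unfolding matroid_rank_def
proof (rule Max_eqI[symmetric])
  show "finite (card ` {X. X \<subseteq> E \<and> indep X})"
    using finite_ground by simp
qed (use assms basis_card_max in \<open>auto simp: basis_def\<close>)

text \<open>Induction on \<open>card (B - A)\<close>, with \<open>A\<close> fixed: one exchange
  moves \<open>B\<close> closer to \<open>A\<close>, and the exchanged pair goes in front of the
  sequence for the new set. Index 0 then gives \<open>B\<close> itself.\<close>

lemma exchange_sequence:
  assumes "indep A" and "indep B" and "card A = card B"
  shows "\<exists>ps. length ps = card (B - A) \<and> fst ` set ps = A - B \<and> snd ` set ps = B - A \<and>
    (\<forall>j\<le>length ps. indep (A \<inter> B \<union> fst ` set (take j ps) \<union> snd ` set (drop j ps)))"
  using assms
proof (induction "card (B - A)" arbitrary: B)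
  case 0
  then have "B \<subseteq> A"
    using indep_finite by auto
  then have "B = A"
    using 0 indep_finite card_subset_eq by metis
  then show ?case using 0 by (intro exI[of _ "[]"]) simp
next
  case (Suc n)
  note fin = indep_finite[OF \<open>indep A\<close>] indep_finite[OF \<open>indep B\<close>]
  obtain b where b: "b \<in> B - A"
    using Suc.hyps(2) by (metis card_eq_0_iff ex_in_conv nat.distinct(1))
  \<comment> \<open>Any \<open>b\<close> will do; augmenting \<open>B - {b}\<close> from
    \<open>A\<close> yields \<open>a\<close>, which differs from \<open>b\<close> because
    \<open>b\<close> is not in \<open>A\<close>.\<close>
  have "card (B - {b}) < card A"
    using b fin Suc.prems(3) by (metis DiffD1 card_Diff1_less)
  then obtain a where a: "a \<in> A - (B - {b})" "indep (insert a (B - {b}))"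
    using indep_augment[of "B - {b}" A] indep_mono[of B "B - {b}"] Suc.prems by blast
  let ?B = "insert a (B - {b})"
  have aAB: "a \<in> A - B" using a b by blast
  have "?B - A = (B - A) - {b}" using aAB by blast
  then have "n = card (?B - A)"
    using Suc.hyps(2) b fin by simp
  moreover have "card A = card ?B"
    using aAB b fin Suc.prems(3) card_Suc_Diff1[of B b] by simp
  ultimately obtain ps where len: "length ps = card (?B - A)"
    and fst: "fst ` set ps = A - ?B" and snd: "snd ` set ps = ?B - A"
    and ind: "\<forall>j\<le>length ps. indep (A \<inter> ?B \<union> fst ` set (take j ps) \<union> snd ` set (drop j ps))"
    using Suc.hyps(1)[of ?B] Suc.prems(1) a(2) by blast
  let ?ps = "(a, b) # ps"
  have "length ?ps = card (B - A)"
    using len \<open>n = card (?B - A)\<close> Suc.hyps(2) by simp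
  moreover have fst': "fst ` set ?ps = A - B" and snd': "snd ` set ?ps = B - A"
    using fst snd aAB b by auto
  moreover have "indep (A \<inter> B \<union> fst ` set (take j ?ps) \<union> snd ` set (drop j ?ps))"
    if "j \<le> length ?ps" for j
  proof (cases j)
    case 0
    have "A \<inter> B \<union> (B - A) = B" by blast
    then show ?thesis
      using 0 snd' Suc.prems(2) by simp
  next
    case (Suc i)
    \<comment> \<open>The entry \<open>a\<close> of the front pair is absorbed into
      \<open>A \<inter> ?B\<close>, so index \<open>Suc i\<close> here is index \<open>i\<close> of
      the sequence for \<open>?B\<close>.\<close>
    have "A \<inter> ?B = insert a (A \<inter> B)" using aAB b by blast
    then show ?thesis
      using ind[rule_format, of i] that Suc by simp
  qed
  ultimately show ?case by blast
qed

end

theorem theorem16: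
  fixes E :: "'a set" and indep :: "'a set \<Rightarrow> bool"
  assumes "matroid E indep"
    and "paving E indep"
  shows "property_P_plus E indep"
  unfolding property_P_plus_def
proof (intro allI impI)
  fix A B
  assume bases: "basis E indep A" "basis E indep B"
  interpret matroid E indep by fact
  have indA: "indep A" and indB: "indep B"
    using bases by (auto simp: basis_def)
  note fin = indep_finite[OF indA] indep_finite[OF indB]
  have cardAB: "card A = card B"
    using card_basis bases by simp
  obtain ps where len: "length ps = card (B - A)"
    and fst: "fst ` set ps = A - B" and snd: "snd ` set ps = B - A"
    and ind: "\<forall>j\<le>length ps. indep (A \<inter> B \<union> fst ` set (take j ps) \<union> snd ` set (drop j ps))"
    using exchange_sequence[OF indA indB cardAB] by blast
  define p where "p = interleave ps"
  have setp: "set p = sym_diff A B"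
    by (simp add: p_def set_interleave fst snd)
  have cardA: "card A = card (A \<inter> B) + card (A - B)"
    using fin by (metis card_Int_Diff)
  have cardB: "card B = card (A \<inter> B) + card (B - A)"
    using fin by (metis card_Int_Diff Int_commute)
  have "card (sym_diff A B) = card (A - B) + card (B - A)"
    using fin by (intro card_Un_disjoint) auto
  \<comment> \<open>By counting: the length \<open>2 * card (B - A)\<close> of \<open>p\<close>
    equals the size of its vertex set.\<close>
  then have "distinct p"
    using setp len cardA cardB cardAB
    by (intro card_distinct) (simp add: p_def length_interleave)
  have "covers p (circuits_in E indep (A \<union> B))"
    unfolding covers_def
  proof (rule ballI, rule ccontr)
    fix C
    assume "C \<in> circuits_in E indep (A \<union> B)"
      and uncovered: "\<not> (\<exists>e\<in>path_edges p. e \<subseteq> C)"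
    then have C: "C \<subseteq> E" "\<not> indep C" "C \<subseteq> A \<union> B"
      by (auto simp: circuits_in_def circuit_def)
    have finC: "finite C" using C(1) finite_ground finite_subset by blast
    let ?F = "filter (\<lambda>u. u \<in> C) p"
    have "successively (\<lambda>u v. \<not> (u \<in> C \<and> v \<in> C)) p"
      using uncovered by (auto simp: successively_conv_nth path_edges_def)
    note free = edge_free_interleave[OF this[unfolded p_def], folded p_def]
    have F: "card (set ?F) = length ?F"
      using \<open>distinct p\<close> by (intro distinct_card) simp
    have setF: "set ?F = C \<inter> sym_diff A B"
      using setp by auto
    have split: "C = C \<inter> (A \<inter> B) \<union> set ?F"
      using C(3) unfolding setF by blast
    have "card C = card (C \<inter> (A \<inter> B)) + card (set ?F)"
      by (subst split, rule card_Un_disjoint) (use finC setF in auto)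
    \<comment> \<open>This is where paving enters: a dependent subset of \<open>E\<close> has at
      least as many elements as the rank.\<close>
    moreover have "card B \<le> card C"
      using assms(2) C card_basis[OF bases(2)] unfolding paving_def by (metis not_le)
    moreover have "card (C \<inter> (A \<inter> B)) \<le> card (A \<inter> B)"
      using fin by (intro card_mono) auto
    \<comment> \<open>The two parts of \<open>C\<close> have at most
      \<open>card (A \<inter> B)\<close> and \<open>length ps\<close> elements, while their sum is
      at least \<open>card B\<close>, the sum of these bounds. So both bounds are attained.\<close>
    ultimately have "length ?F = length ps" and "card (C \<inter> (A \<inter> B)) = card (A \<inter> B)"
      using free F len cardB by linarith+
    moreover from this(2) have "C \<inter> (A \<inter> B) = A \<inter> B"
      using fin by (intro card_subset_eq) auto
    ultimately obtain j where "j \<le> length ps"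
      "C = A \<inter> B \<union> (fst ` set (take j ps) \<union> snd ` set (drop j ps))"
      using free split by metis
    then show False
      using ind C(2) by (simp add: Un_assoc)
  qed
  moreover have "path_on (sym_diff A B) p"
    using \<open>distinct p\<close> setp by (simp add: path_on_def)
  moreover have "alternates (A - B) (B - A) p"
    unfolding p_def by (rule alternates_interleave) (simp_all add: fst snd)
  ultimately show "\<exists>p. path_on (sym_diff A B) p \<and> alternates (A - B) (B - A) p \<and>
      covers p (circuits_in E indep (A \<union> B))"
    by blast
qed

end
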